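(* Let an instance of the convex projection problem (CPP) be given by $G\in\mathbb{R}^{q\times n}$ and $g_1,\dots,g_m$, with feasible set $X$ and $Y=\{Gx : x\in X\}\subseteq\mathbb{R}^q$. Let $\varepsilon>0$, and let $\mathcal{P}_{inner}$ be the result of the dual Benson type algorithm (described in the context) applied with tolerance $\varepsilon$ to the associated multiobjective convex program (MOCP). Let $Y_{inner} := \pi[\mathcal{P}_{inner}\cap H]$. Then $Y_{inner}\subseteq Y$ and $$d_H(Y_{inner},Y)\le \varepsilon\sqrt{q^2+q-1}.$$
   Context: Notation: $e$ is the all-ones vector of appropriate dimension, inequalities between vectors are componentwise, $\mathbb{R}^{q+1}_+=\{y\in\mathbb{R}^{q+1}: y\ge 0\}$. $\pi:\mathbb{R}^{q+1}\to\mathbb{R}^q$ omits the last component, and $\pi[A]=\{\pi(a):a\in A\}$. $H=\{y\in\mathbb{R}^{q+1}: e^Ty=0\}$. $d_H$ is the Hausdorff distance with respect to the Euclidean norm; for nonempty $M\subseteq N$ it equals $d_H(M,N)=\sup_{b\in N}\inf_{a\in M}\|a-b\|_2$. Problem (CPP): $G\in\mathbb{R}^{q\times n}$ has full row rank; $g_1,\dots,g_m:\mathbb{R}^n\to\mathbb{R}\cup\{\infty\}$ are convex; the feasible set $X=\{x\in\mathbb{R}^n: g_1(x)\le 0,\dots,g_m(x)\le 0\}$ is assumed to be a convex body (convex, compact, with nonempty interior); the set to be approximated is $Y=\{Gx: x\in X\}$. Associated (MOCP): minimize $\Gamma(x)=\begin{pmatrix}Gx\\ -e^TGx\end{pmatrix}\in\mathbb{R}^{q+1}$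 with respect to the componentwise order subject to $x\in X$. Its upper image is $\mathcal{P}=\Gamma[X]+\mathbb{R}^{q+1}_+$, where $\Gamma[X]=\{\Gamma(x):x\in X\}$. For $t\in\mathbb{R}^{q+1}$ put $w(t)=(t_1,\dots,t_q,1-\sum_{i=1}^q t_i)^T$. The coupling function is $\varphi(y,y^* )=\sum_{i=1}^q y_iy_i^*+y_{q+1}\bigl(1-\sum_{i=1}^q y_i^*\bigr)-y^*_{q+1}$ for $y,y^*\in\mathbb{R}^{q+1}$. For $w\in\mathbb{R}^{q+1}$ with $e^Tw=1$, $(P_1(w))$ is the problem $\min_x w^T\Gamma(x)$ subject to $x\in X$. Dual Benson type algorithm with tolerance $\varepsilon>0$: (1) Choose some $\bar w>0$ (all components positive) with $e^T\bar w=1$, let $\bar x$ be an optimal solution of $(P_1(\bar w))$, $\mathcal{P}_0=\{\Gamma(\bar x)\}+\mathbb{R}^{q+1}_+$ and $\mathcal{D}_0=\{y^*\in\mathbb{R}^{q+1}: \varphi(y,y^* )\ge 0\ \text{for all } y\in\mathcal{P}_0\}$. Set $T:=\emptyset$, $\mathcal{D}_{outer}:=\mathcal{D}_0$, and let $\bar T$ be the vertex set of $\mathcal{D}_{outer}$. (2) While $\bar T\setminus T\neq\emptyset$: choose any $t\in\bar T\setminus T$; compute an optimal solution $x$ of $(P_1(w(t)))$; if $\varphi(\Gamma(x),t)<-\varepsilon$, replace $\mathcal{D}_{outer}$ by $\mathcal{D}_{outer}\cap\{y^*\in\mathbb{R}^{q+1}:\varphi(\Gamma(x),y^* )\ge 0\}$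 and let $\bar T$ be the vertex set of the new $\mathcal{D}_{outer}$; otherwise replace $T$ by $T\cup\{t\}$. (3) When the loop ends, return $\mathcal{P}_{inner}=\{y\in\mathbb{R}^{q+1}: \varphi(y,y^* )\ge 0\ \text{for all } y^*\in\mathcal{D}_{outer}\}$. The "result" of the algorithm is the set $\mathcal{P}_{inner}$ returned upon termination. *)

theory Defs
  imports "HOL-Analysis.Analysis"
begin

text \<open>
  Vectors of dimension \<open>q + 1\<close> are pairs in \<^typ>\<open>(real^'q) \<times> real\<close>, the second
  component being the last coordinate; the norm, inner product and order of the product
  type are the Euclidean and componentwise ones.  The projection omitting the last
  coordinate is \<^const>\<open>fst\<close>.
\<close>

type_synonym 'q evec = "(real^'q) \<times> real"

definition all_ones :: "'q::finite evec" where
  "all_ones = (1, 1)"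

definition nonneg_orthant :: "'q::finite evec set" where
  "nonneg_orthant = {y. 0 \<le> y}"

text \<open>The strict order of the library is not componentwise, hence the explicit form.\<close>

definition all_pos :: "'q::finite evec \<Rightarrow> bool" where
  "all_pos y \<longleftrightarrow> (\<forall>i. fst y $ i > 0) \<and> snd y > 0"

definition hyperplane_H :: "'q::finite evec set" where
  "hyperplane_H = {y. all_ones \<bullet> y = 0}"

text \<open>
  Values are extended reals so that an empty argument does not yield a spurious finite
  distance: the distance of the empty set to a nonempty set is \<open>\<infinity>\<close>.
\<close>

definition hausdorff_dist :: "'a::metric_space set \<Rightarrow> 'a set \<Rightarrow> ereal" where
  "hausdorff_dist A B =
     max (SUP a\<in>A. INF b\<in>B. ereal (dist a b)) (SUP b\<in>B. INF a\<in>A. ereal (dist a b))"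

text \<open>
  Convexity of a function into \<open>\<real> \<union> {\<infinity>}\<close>, with the library convention \<open>0 * \<infinity> = 0\<close>.
\<close>

definition convex_ext :: "('a::real_vector \<Rightarrow> ereal) \<Rightarrow> bool" where
  "convex_ext g \<longleftrightarrow> (\<forall>x. g x \<noteq> -\<infinity>) \<and>
     (\<forall>x y u v. 0 \<le> u \<and> 0 \<le> v \<and> u + v = 1 \<longrightarrow>
        g (u *\<^sub>R x + v *\<^sub>R y) \<le> ereal u * g x + ereal v * g y)"

definition convex_body :: "'a::euclidean_space set \<Rightarrow> bool" where
  "convex_body S \<longleftrightarrow> convex S \<and> compact S \<and> interior S \<noteq> {}"

definition feasible_set :: "nat \<Rightarrow> (nat \<Rightarrow> 'a \<Rightarrow> ereal) \<Rightarrow> 'a set" where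
  "feasible_set m g = {x. \<forall>i\<in>{1..m}. g i x \<le> 0}"

definition mocp_objective :: "real^'n^'q \<Rightarrow> real^'n \<Rightarrow> 'q::finite evec" where
  "mocp_objective G x = (G *v x, - (1 \<bullet> (G *v x)))"

definition weight :: "'q::finite evec \<Rightarrow> 'q evec" where
  "weight t = (fst t, 1 - (\<Sum>i\<in>UNIV. fst t $ i))"

definition coupling :: "'q::finite evec \<Rightarrow> 'q evec \<Rightarrow> real" where
  "coupling y ys =
     (\<Sum>i\<in>UNIV. fst y $ i * fst ys $ i) + snd y * (1 - (\<Sum>i\<in>UNIV. fst ys $ i)) - snd ys"

definition optimal_P1 ::
  "('x \<Rightarrow> 'q::finite evec) \<Rightarrow> 'x set \<Rightarrow> 'q evec \<Rightarrow> 'x \<Rightarrow> bool" where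
  "optimal_P1 \<Gamma> X w x \<longleftrightarrow> is_arg_min (\<lambda>x. w \<bullet> \<Gamma> x) (\<lambda>x. x \<in> X) x"

definition vertices :: "'a::real_vector set \<Rightarrow> 'a set" where
  "vertices S = {v. v extreme_point_of S}"

text \<open>
  States of the dual Benson type algorithm that are reachable by some sequence of choices
  of the initial weight, the vertices and the optimal solutions.  The arguments are
  \<open>T\<close>, \<open>\<T>\<close> (the vertex set last computed) and \<open>D\<close> (the current outer approximation).
\<close>

inductive dual_benson_state ::
  "('x \<Rightarrow> 'q::finite evec) \<Rightarrow> 'x set \<Rightarrow> real \<Rightarrow>
     'q evec set \<Rightarrow> 'q evec set \<Rightarrow> 'q evec set \<Rightarrow> bool"
  for \<Gamma> :: "'x \<Rightarrow> 'q::finite evec" and X :: "'x set" and \<epsilon> :: real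
where
  init: "\<lbrakk>all_pos w; all_ones \<bullet> w = 1; optimal_P1 \<Gamma> X w x;
          P0 = {\<Gamma> x} + nonneg_orthant;
          D0 = {ys. \<forall>y\<in>P0. coupling y ys \<ge> 0}\<rbrakk>
         \<Longrightarrow> dual_benson_state \<Gamma> X \<epsilon> {} (vertices D0) D0"
| cut: "\<lbrakk>dual_benson_state \<Gamma> X \<epsilon> T \<T> D; t \<in> \<T> - T; optimal_P1 \<Gamma> X (weight t) x;
         coupling (\<Gamma> x) t < - \<epsilon>;
         D' = D \<inter> {ys. coupling (\<Gamma> x) ys \<ge> 0}\<rbrakk>
        \<Longrightarrow> dual_benson_state \<Gamma> X \<epsilon> T (vertices D') D'"
| accept: "\<lbrakk>dual_benson_state \<Gamma> X \<epsilon> T \<T> D; t \<in> \<T> - T; optimal_P1 \<Gamma> X (weight t) x;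
            \<not> coupling (\<Gamma> x) t < - \<epsilon>\<rbrakk>
           \<Longrightarrow> dual_benson_state \<Gamma> X \<epsilon> (T \<union> {t}) \<T> D"

definition dual_benson_result ::
  "('x \<Rightarrow> 'q::finite evec) \<Rightarrow> 'x set \<Rightarrow> real \<Rightarrow> 'q evec set \<Rightarrow> bool" where
  "dual_benson_result \<Gamma> X \<epsilon> P \<longleftrightarrow>
     (\<exists>T \<T> D. dual_benson_state \<Gamma> X \<epsilon> T \<T> D \<and> \<T> - T = {} \<and>
        P = {y. \<forall>ys\<in>D. coupling y ys \<ge> 0})"

end

theory Submission
  imports Defs
begin

text \<open>
  The outer approximations are all of one kind: \<open>outer_dual S\<close>, the hypograph of
  \<open>w \<mapsto> Min {w \<bullet> p | p \<in> S}\<close> over the simplex of nonnegative weights with sum one, where \<open>S\<close> is the finite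
  set of the image points \<open>\<Gamma> x\<close> found so far.  Each cut only adds a point to \<open>S\<close>.  A
  separation argument (\<open>primal_of_outer_dual\<close>) shows that the primal set belonging to
  \<open>outer_dual S\<close> is \<open>convex hull S + nonneg_orthant\<close>.  All of \<open>S\<close> lies in the hyperplane \<open>H\<close>,
  on which coordinates sum to zero, and a nonnegative vector with that property vanishes;
  intersecting with \<open>H\<close> therefore leaves just \<open>convex hull S\<close>.  This is a subset of the convex
  set \<open>\<Gamma> ` X\<close>, which gives \<open>Y_inner \<subseteq> Y\<close>.

  On termination every vertex \<open>t\<close> of the outer approximation has been accepted, which means
  \<open>coupling (\<Gamma> x) t \<ge> - \<epsilon>\<close> for all feasible \<open>x\<close>.  The coupling function is affine in its second
  argument and attains its minimum over \<open>outer_dual S\<close> at a vertex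
  (\<open>coupling_minimized_at_vertex\<close>), so the inequality holds on the whole outer approximation.
  Weights being normalized, this says that \<open>\<Gamma> x + \<epsilon> e\<close> belongs to the inner approximation,
  \<open>e\<close> being the all-ones vector: \<open>\<Gamma> x + \<epsilon> e = p + r\<close> with \<open>p \<in> convex hull S\<close> and \<open>r \<ge> 0\<close>.
  Both \<open>\<Gamma> x\<close> and \<open>p\<close> lie in \<open>H\<close>, so the \<open>q + 1\<close> entries of \<open>r\<close> sum to \<open>(q + 1) \<epsilon>\<close>.  The first
  \<open>q\<close> coordinates of \<open>r - \<epsilon> e\<close> are longest when one of them carries the whole sum; their squared
  length is then \<open>q\<^sup>2 \<epsilon>\<^sup>2 + (q - 1) \<epsilon>\<^sup>2\<close> (\<open>norm_fst_le_in_hyperplane\<close>), the square of the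
  claimed bound.
\<close>

section \<open>Geometric duality\<close>

lemma coupling_eq_inner: "coupling y t = weight t \<bullet> y - snd t"
  by (simp add: coupling_def weight_def inner_prod_def inner_vec_def mult.commute)

lemma all_ones_inner: "all_ones \<bullet> y = (\<Sum>i\<in>UNIV. fst y $ i) + snd y"
  by (simp add: all_ones_def inner_prod_def inner_vec_def)

lemma all_ones_inner_weight: "all_ones \<bullet> weight t = 1"
  by (simp add: all_ones_inner weight_def)

lemma weight_normalized:
  assumes "all_ones \<bullet> w = 1"
  shows "weight (fst w, b) = w"
  using assms by (cases w) (simp add: all_ones_inner weight_def)

lemma all_ones_inner_pos:
  assumes "0 \<le> a" and "a \<noteq> 0"
  shows "0 < all_ones \<bullet> a"
proof -
  have nonneg: "0 \<le> fst a $ i" "0 \<le> snd a" for i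
    using assms(1) by (simp_all add: less_eq_prod_def less_eq_vec_def)
  have "all_ones \<bullet> a \<noteq> 0"
  proof
    assume "all_ones \<bullet> a = 0"
    then have "(\<Sum>i\<in>UNIV. fst a $ i) = 0" "snd a = 0"
      using nonneg sum_nonneg[of UNIV "\<lambda>i. fst a $ i"] by (auto simp: all_ones_inner)
    then have "a = 0"
      using nonneg by (simp add: sum_nonneg_eq_0_iff prod_eq_iff vec_eq_iff)
    with assms(2) show False by simp
  qed
  moreover have "0 \<le> all_ones \<bullet> a"
    using nonneg by (simp add: all_ones_inner sum_nonneg)
  ultimately show ?thesis by simp
qed

lemma nonneg_iff_Basis:
  fixes a :: "'a::ordered_euclidean_space"
  shows "0 \<le> a \<longleftrightarrow> (\<forall>i\<in>Basis. 0 \<le> a \<bullet> i)"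
  by (subst eucl_le) simp

lemma inner_nonneg_ordered:
  fixes a b :: "'a::ordered_euclidean_space"
  assumes "0 \<le> a" and "0 \<le> b"
  shows "0 \<le> a \<bullet> b"
  unfolding euclidean_inner[of a b]
  by (intro sum_nonneg mult_nonneg_nonneg) (use assms nonneg_iff_Basis[of a] nonneg_iff_Basis[of b] in blast)+

text \<open>
  Moving along a basis vector \<open>i\<close> with \<open>a \<bullet> i < 0\<close> inside the cone would make the inner product
  arbitrarily small.
\<close>

lemma nonneg_if_inner_bounded_below:
  fixes a :: "'a::ordered_euclidean_space"
  assumes bound: "\<And>r. 0 \<le> r \<Longrightarrow> c \<le> a \<bullet> r"
  shows "0 \<le> a"
proof -
  have "0 \<le> a \<bullet> i" if i: "i \<in> Basis" for i
  proof (rule ccontr)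
    assume neg: "\<not> 0 \<le> a \<bullet> i"
    \<comment> \<open>This multiple of \<open>i\<close> has inner product \<open>- \<bar>c\<bar> - 1 < c\<close> with \<open>a\<close>.\<close>
    define k where "k = (\<bar>c\<bar> + 1) / - (a \<bullet> i)"
    have "0 \<le> k" using neg unfolding k_def by (intro divide_nonneg_nonneg) auto
    moreover have "0 \<le> i"
      unfolding nonneg_iff_Basis[of i] using i by (simp add: inner_Basis)
    ultimately have "0 \<le> k *\<^sub>R i" by (rule scaleR_nonneg_nonneg)
    from bound[OF this] have "c \<le> k * (a \<bullet> i)" by simp
    also have "k * (a \<bullet> i) = - (\<bar>c\<bar> + 1)" using neg by (simp add: k_def)
    finally show False by simp
  qed
  then show ?thesis unfolding nonneg_iff_Basis[of a] by blast
qed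

definition outer_dual :: "'q::finite evec set \<Rightarrow> 'q evec set" where
  "outer_dual S = {ys. 0 \<le> weight ys \<and> (\<forall>p\<in>S. 0 \<le> coupling p ys)}"

text \<open>
  The inequalities for the points \<open>p + r\<close> with large \<open>r \<ge> 0\<close> force the weight to be nonnegative,
  and then the one for \<open>p\<close> itself implies all others.  So the initial outer approximation of the
  algorithm is an \<open>outer_dual\<close>.
\<close>

lemma dual_of_translated_orthant:
  "{ys. \<forall>y\<in>{p} + nonneg_orthant. 0 \<le> coupling y ys} = outer_dual {p}"
proof (intro set_eqI iffI)
  fix ys assume "ys \<in> {ys. \<forall>y\<in>{p} + nonneg_orthant. 0 \<le> coupling y ys}"
  then have all: "0 \<le> coupling (p + r) ys" if "0 \<le> r" for r
    using that set_plus_intro[of p "{p}" r nonneg_orthant] by (simp add: nonneg_orthant_def)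
  have "- coupling p ys \<le> weight ys \<bullet> r" if "0 \<le> r" for r
    using all[OF that] unfolding coupling_eq_inner inner_add_right by linarith
  then have "0 \<le> weight ys" by (rule nonneg_if_inner_bounded_below)
  with all[of 0] show "ys \<in> outer_dual {p}" by (simp add: outer_dual_def)
next
  fix ys assume ys: "ys \<in> outer_dual {p}"
  have "0 \<le> coupling (p + r) ys" if "0 \<le> r" for r
  proof -
    have "0 \<le> weight ys \<bullet> r"
      using ys that by (intro inner_nonneg_ordered) (simp_all add: outer_dual_def)
    with ys show ?thesis by (simp add: outer_dual_def coupling_eq_inner inner_add_right)
  qed
  then show "ys \<in> {ys. \<forall>y\<in>{p} + nonneg_orthant. 0 \<le> coupling y ys}"
    unfolding set_plus_def nonneg_orthant_def by blast
qed

text \<open>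
  This is a bipolar theorem.  Finiteness of \<open>S\<close> makes the right-hand side closed, so a point \<open>y\<close>
  outside it is strictly separated from it by some \<open>a\<close>.  As \<open>a\<close> is bounded below on a translated
  orthant, it is nonnegative; rescaled to coordinate sum one, it is a weight, and together with
  the separating level it forms a point of \<open>outer_dual S\<close> whose coupling with \<open>y\<close> is negative.
\<close>

lemma primal_of_outer_dual:
  assumes "finite S" and "S \<noteq> {}"
  shows "{y. \<forall>ys\<in>outer_dual S. 0 \<le> coupling y ys} = convex hull S + nonneg_orthant"
proof (intro set_eqI iffI)
  fix y assume "y \<in> convex hull S + nonneg_orthant"
  then obtain p r where y: "y = p + r" and p: "p \<in> convex hull S" and r: "0 \<le> r"
    unfolding set_plus_def nonneg_orthant_def by blast
  have "0 \<le> coupling y ys" if ys: "ys \<in> outer_dual S" for ys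
  proof -
    have "convex hull S \<subseteq> {p. weight ys \<bullet> p \<ge> snd ys}"
      using ys by (intro hull_minimal convex_halfspace_ge)
        (auto simp: outer_dual_def coupling_eq_inner)
    moreover have "0 \<le> weight ys \<bullet> r"
      using ys r by (intro inner_nonneg_ordered) (simp_all add: outer_dual_def)
    ultimately show ?thesis
      using p y by (force simp: coupling_eq_inner inner_add_right)
  qed
  then show "y \<in> {y. \<forall>ys\<in>outer_dual S. 0 \<le> coupling y ys}" by simp
next
  fix y assume y: "y \<in> {y. \<forall>ys\<in>outer_dual S. 0 \<le> coupling y ys}"
  show "y \<in> convex hull S + nonneg_orthant"
  proof (rule ccontr)
    assume notin: "y \<notin> convex hull S + nonneg_orthant"
    have orthant: "nonneg_orthant = {0::'a evec..}"
      by (auto simp: nonneg_orthant_def)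
    have "convex (nonneg_orthant :: 'a evec set)"
      unfolding nonneg_orthant_def
      by (rule convexI) (simp only: mem_Collect_eq add_nonneg_nonneg scaleR_nonneg_nonneg)
    then have "convex (convex hull S + nonneg_orthant)"
      by (intro convex_set_plus convex_convex_hull)
    moreover have "closed (nonneg_orthant :: 'a evec set)"
      unfolding orthant by (rule closed_eucl_atLeast)
    then have "closed (\<Union>x\<in>convex hull S. \<Union>y\<in>nonneg_orthant. {x + y})"
      by (intro compact_closed_sums finite_imp_compact_convex_hull assms(1))
    then have "closed (convex hull S + nonneg_orthant)"
      by (rule back_subst[where P = closed]) (unfold set_plus_def, blast)
    ultimately obtain a b where a_y: "a \<bullet> y < b"
      and a_sep: "\<And>z. z \<in> convex hull S + nonneg_orthant \<Longrightarrow> b < a \<bullet> z"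
      using separating_hyperplane_closed_point[OF _ _ notin] by blast
    have sep: "b < a \<bullet> p + a \<bullet> r" if "p \<in> S" "0 \<le> r" for p r
    proof -
      have "p + r \<in> convex hull S + nonneg_orthant"
        using that by (intro set_plus_intro hull_inc) (simp_all add: nonneg_orthant_def)
      from a_sep[OF this] show ?thesis by (simp only: inner_add_right)
    qed
    obtain p0 where p0: "p0 \<in> S" using assms(2) by blast
    have "0 \<le> a"
      by (rule nonneg_if_inner_bounded_below[where c = "b - a \<bullet> p0"])
        (use sep[OF p0] in \<open>simp add: diff_le_eq add.commute less_imp_le\<close>)
    moreover have "a \<noteq> 0" using a_y sep[OF p0, of 0] by force
    ultimately have s: "0 < all_ones \<bullet> a" by (rule all_ones_inner_pos)
    define w where "w = a /\<^sub>R (all_ones \<bullet> a)"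
    define ys where "ys = (fst w, b / (all_ones \<bullet> a))"
    have weight_ys: "weight ys = w"
      unfolding ys_def by (rule weight_normalized) (use s in \<open>simp add: w_def\<close>)
    have coup: "coupling z ys = (a \<bullet> z - b) / (all_ones \<bullet> a)" for z
      unfolding coupling_eq_inner weight_ys
      by (simp add: ys_def w_def divide_inverse algebra_simps)
    have "0 \<le> w" using \<open>0 \<le> a\<close> s by (simp add: w_def scaleR_nonneg_nonneg)
    moreover have "0 \<le> coupling p ys" if "p \<in> S" for p
      using sep[OF that, of 0] s unfolding coup by (intro divide_nonneg_pos) simp_all
    ultimately have "ys \<in> outer_dual S" by (simp add: outer_dual_def weight_ys)
    with y have "0 \<le> coupling y ys" by blast
    moreover have "coupling y ys < 0" using a_y s by (simp add: coup divide_neg_pos)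
    ultimately show False by linarith
  qed
qed

section \<open>Vertices of the outer approximation\<close>

text \<open>
  The normal vector is made explicit for the half-space and supporting hyperplane arguments
  below.
\<close>

lemma coupling_affine:
  "coupling y t = ((fst y - (\<chi> i. snd y)), - 1) \<bullet> t + snd y"
  by (simp add: coupling_def inner_prod_def inner_vec_def algebra_simps sum_subtractf
      sum_distrib_left)

lemma convex_outer_dual: "convex (outer_dual S)"
proof -
  have "weight (u *\<^sub>R x + v *\<^sub>R y) = u *\<^sub>R weight x + v *\<^sub>R weight y"
    if "u + v = 1" for u v and x y :: "'a evec"
    using that by (simp add: weight_def sum.distrib sum_distrib_left algebra_simps)
  then have "convex {ys :: 'a evec. 0 \<le> weight ys}"
    by (intro convexI) (simp only: mem_Collect_eq add_nonneg_nonneg scaleR_nonneg_nonneg)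
  moreover have "convex {ys. 0 \<le> coupling p ys}" for p :: "'a evec"
  proof -
    have "{ys. 0 \<le> coupling p ys} = {ys. (fst p - (\<chi> i. snd p), - 1) \<bullet> ys \<ge> - snd p}"
      unfolding coupling_affine by (intro Collect_cong) linarith
    then show ?thesis by (simp only: convex_halfspace_ge)
  qed
  moreover have "outer_dual S = {ys. 0 \<le> weight ys} \<inter> (\<Inter>p\<in>S. {ys. 0 \<le> coupling p ys})"
    by (auto simp: outer_dual_def)
  ultimately show ?thesis by (simp add: convex_Int convex_INT)
qed

lemma closed_outer_dual: "closed (outer_dual S)"
proof -
  have "closed {ys :: 'a evec. 0 \<le> weight ys}"
    unfolding weight_def less_eq_prod_def less_eq_vec_def
    by (auto intro!: closed_Collect_conj closed_Collect_all closed_Collect_le continuous_intros)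
  moreover have "closed {ys. 0 \<le> coupling p ys}" for p :: "'a evec"
    unfolding coupling_def by (intro closed_Collect_le continuous_intros)
  moreover have "outer_dual S = {ys. 0 \<le> weight ys} \<inter> (\<Inter>p\<in>S. {ys. 0 \<le> coupling p ys})"
    by (auto simp: outer_dual_def)
  ultimately show ?thesis by (simp add: closed_Int closed_INT)
qed

text \<open>
  Although \<open>outer_dual S\<close> is unbounded in the direction of decreasing last coordinate, the coupling
  with any fixed \<open>y\<close> grows in this direction.  A bound \<open>coupling y t \<le> c\<close> thus bounds the last
  coordinate of \<open>t\<close> from below, a constraint \<open>coupling p t \<ge> 0\<close> with \<open>p \<in> S\<close> bounds it from
  above, and the other coordinates range over a simplex.
\<close>

lemma compact_coupling_sublevel:
  assumes "S \<noteq> {}"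
  shows "compact (outer_dual S \<inter> {t. coupling y t \<le> c})"
proof -
  obtain p where p: "p \<in> S" using assms by blast
  let ?K = "{0..1::real^'a}"
  have bnd: "\<exists>B. \<forall>a\<in>?K. \<bar>weight (a, 0) \<bullet> z\<bar> \<le> B" for z :: "'a evec"
  proof -
    have "compact ((\<lambda>a. weight (a, 0::real) \<bullet> z) ` ?K)"
      unfolding weight_def
      by (intro compact_continuous_image continuous_intros compact_interval)
    then have "bounded ((\<lambda>a. weight (a, 0::real) \<bullet> z) ` ?K)" by (rule compact_imp_bounded)
    then show ?thesis by (simp add: bounded_iff)
  qed
  obtain B B' where B: "\<And>a. a \<in> ?K \<Longrightarrow> \<bar>weight (a, 0) \<bullet> p\<bar> \<le> B"
    and B': "\<And>a. a \<in> ?K \<Longrightarrow> \<bar>weight (a, 0) \<bullet> y\<bar> \<le> B'"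
    using bnd[of p] bnd[of y] by blast
  have "outer_dual S \<inter> {t. coupling y t \<le> c} \<subseteq> ?K \<times> {- B' - c..B}"
  proof
    fix t assume t: "t \<in> outer_dual S \<inter> {t. coupling y t \<le> c}"
    obtain a b where ab: "t = (a, b)" by (cases t)
    have w: "weight t = weight (a, 0)" by (simp add: weight_def ab)
    have nonneg: "0 \<le> a $ i" and le: "(\<Sum>i\<in>UNIV. a $ i) \<le> 1" for i
      using t by (auto simp: outer_dual_def weight_def ab less_eq_prod_def less_eq_vec_def)
    have "a $ i \<le> 1" for i
      using member_le_sum[of i UNIV "\<lambda>i. a $ i"] nonneg le by fastforce
    with nonneg have a: "a \<in> ?K" by (simp add: less_eq_vec_def)
    have "0 \<le> weight (a, 0) \<bullet> p - b" "weight (a, 0) \<bullet> y - b \<le> c"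
      using t p by (auto simp: outer_dual_def coupling_eq_inner w) (auto simp: ab)
    with B[OF a] B'[OF a] have "b \<in> {- B' - c..B}" by auto
    with a show "t \<in> ?K \<times> {- B' - c..B}" by (simp add: ab)
  qed
  then have "bounded (outer_dual S \<inter> {t. coupling y t \<le> c})"
    by (rule bounded_subset[rotated]) (intro bounded_Times compact_imp_bounded compact_interval)
  moreover have "closed {t. coupling y t \<le> c}"
    unfolding coupling_def by (intro closed_Collect_le continuous_intros)
  ultimately show ?thesis
    by (simp add: compact_eq_bounded_closed closed_Int closed_outer_dual)
qed

text \<open>
  By compactness of its sublevel sets the coupling attains its minimum over \<open>outer_dual S\<close>.  The
  minimizers form a face, which is compact for the same reason and so has an extreme point; this
  is an extreme point of \<open>outer_dual S\<close> as well.
\<close>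

lemma coupling_minimized_at_vertex:
  assumes "S \<noteq> {}" and t: "t \<in> outer_dual S"
  obtains v where "v \<in> vertices (outer_dual S)" and "coupling y v \<le> coupling y t"
proof -
  let ?D = "outer_dual S" and ?f = "coupling y"
  let ?L = "?D \<inter> {s. ?f s \<le> ?f t}"
  have "continuous_on ?L ?f" unfolding coupling_def by (intro continuous_intros)
  then obtain u where u: "u \<in> ?L" and u_min: "\<And>s. s \<in> ?L \<Longrightarrow> ?f u \<le> ?f s"
    using continuous_attains_inf[OF compact_coupling_sublevel[OF assms(1)], of y "?f t" ?f] t
    by blast
  define a where "a = ((fst y - (\<chi> i. snd y)), - 1::real)"
  define F where "F = ?D \<inter> {s. a \<bullet> s = a \<bullet> u}"
  have f: "?f s = a \<bullet> s + snd y" for s by (simp add: a_def coupling_affine)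
  have "a \<bullet> s \<ge> a \<bullet> u" if "s \<in> ?D" for s
    using that u u_min[of s] by (cases "?f s \<le> ?f t") (auto simp: f)
  then have face: "F face_of ?D"
    unfolding F_def by (intro face_of_Int_supporting_hyperplane_ge convex_outer_dual)
  have "F = (?D \<inter> {s. ?f s \<le> ?f u}) \<inter> {s. a \<bullet> s = a \<bullet> u}"
    by (auto simp: F_def f)
  then have "compact F"
    using compact_coupling_sublevel[OF assms(1)] by (simp add: compact_Int_closed closed_hyperplane)
  moreover have "convex F" using face by (rule face_of_imp_convex)
  moreover have "F \<noteq> {}" using u by (auto simp: F_def)
  ultimately obtain v where "v extreme_point_of F"
    using extreme_point_exists_convex by blast
  then have "v \<in> vertices ?D" "v \<in> F"
    using face by (auto simp: vertices_def extreme_point_of_face)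
  moreover then have "?f v \<le> ?f t" using u by (auto simp: F_def f)
  ultimately show ?thesis using that by blast
qed

section \<open>The algorithm\<close>

text \<open>
  Acceptance of \<open>t\<close> tests one optimal solution of the weighted problem; by optimality the
  same estimate holds for every feasible point.
\<close>

lemma dual_benson_state_invariant:
  assumes "dual_benson_state \<Gamma> X \<epsilon> T V D"
  shows "(\<exists>S. finite S \<and> S \<noteq> {} \<and> S \<subseteq> \<Gamma> ` X \<and> D = outer_dual S) \<and> V = vertices D \<and>
    (\<forall>t\<in>T. \<forall>x\<in>X. - \<epsilon> \<le> coupling (\<Gamma> x) t)"
  using assms
proof induction
  case (init w x P0 D0)
  then have "D0 = outer_dual {\<Gamma> x}" "x \<in> X"
    by (simp_all only: dual_of_translated_orthant optimal_P1_def is_arg_min_def)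
  then show ?case by (auto intro!: exI[of _ "{\<Gamma> x}"])
next
  case (cut T V D t x D')
  then obtain S where S: "finite S" "S \<subseteq> \<Gamma> ` X" "D = outer_dual S" by blast
  have "x \<in> X" using cut by (auto simp: optimal_P1_def is_arg_min_def)
  moreover have "D' = outer_dual (insert (\<Gamma> x) S)"
    using cut.hyps S by (auto simp: outer_dual_def)
  ultimately have "\<exists>S. finite S \<and> S \<noteq> {} \<and> S \<subseteq> \<Gamma> ` X \<and> D' = outer_dual S"
    using S by (intro exI[of _ "insert (\<Gamma> x) S"]) auto
  with cut.IH show ?case by blast
next
  case (accept T V D t x)
  have "- \<epsilon> \<le> coupling (\<Gamma> z) t" if "z \<in> X" for z
  proof -
    have "weight t \<bullet> \<Gamma> x \<le> weight t \<bullet> \<Gamma> z"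
      using accept.hyps that by (auto simp: optimal_P1_def is_arg_min_linorder)
    then show ?thesis using accept.hyps by (simp add: coupling_eq_inner)
  qed
  with accept.IH show ?case by blast
qed

text \<open>
  Adding \<open>\<epsilon> *\<^sub>R all_ones\<close> to the first argument raises the coupling by exactly \<open>\<epsilon>\<close>, because
  weights have coordinate sum one.  This compensates the slack \<open>- \<epsilon>\<close> at the accepted vertices,
  and the minimum over the outer approximation is attained at one of these.
\<close>

lemma dual_benson_result_characterization:
  assumes "dual_benson_result \<Gamma> X \<epsilon> P"
  obtains S where "S \<subseteq> \<Gamma> ` X" "P = convex hull S + nonneg_orthant"
    and "\<And>x. x \<in> X \<Longrightarrow> \<Gamma> x + \<epsilon> *\<^sub>R all_ones \<in> P"
proof -
  from assms obtain T V D where state: "dual_benson_state \<Gamma> X \<epsilon> T V D" and "V - T = {}"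
    and P: "P = {y. \<forall>ys\<in>D. coupling y ys \<ge> 0}"
    by (auto simp: dual_benson_result_def)
  from dual_benson_state_invariant[OF state]
  obtain S where S: "finite S" "S \<noteq> {}" "S \<subseteq> \<Gamma> ` X" and D: "D = outer_dual S"
    and V: "V = vertices D" and T: "\<And>t x. t \<in> T \<Longrightarrow> x \<in> X \<Longrightarrow> - \<epsilon> \<le> coupling (\<Gamma> x) t"
    by blast
  have "\<Gamma> x + \<epsilon> *\<^sub>R all_ones \<in> P" if x: "x \<in> X" for x
  proof -
    have "0 \<le> coupling (\<Gamma> x + \<epsilon> *\<^sub>R all_ones) t" if "t \<in> D" for t
    proof -
      obtain v where "v \<in> V" and "coupling (\<Gamma> x) v \<le> coupling (\<Gamma> x) t"
        using coupling_minimized_at_vertex[of S t "\<Gamma> x"] S \<open>t \<in> D\<close> D V by auto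
      moreover have "- \<epsilon> \<le> coupling (\<Gamma> x) v"
        using T x \<open>v \<in> V\<close> \<open>V - T = {}\<close> by blast
      moreover have "coupling (\<Gamma> x + \<epsilon> *\<^sub>R all_ones) t = coupling (\<Gamma> x) t + \<epsilon>"
        using all_ones_inner_weight[of t]
        by (simp add: coupling_eq_inner inner_add_right inner_commute)
      ultimately show ?thesis by simp
    qed
    then show ?thesis by (simp add: P)
  qed
  moreover have "P = convex hull S + nonneg_orthant"
    using primal_of_outer_dual[OF S(1,2)] P D by simp
  ultimately show ?thesis using S that by blast
qed

section \<open>The error bound\<close>

lemma sum_squares_le_square_sum:
  fixes f :: "'a \<Rightarrow> real"
  assumes "finite A" and "\<And>i. i \<in> A \<Longrightarrow> 0 \<le> f i"
  shows "(\<Sum>i\<in>A. (f i)\<^sup>2) \<le> (\<Sum>i\<in>A. f i)\<^sup>2"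
proof -
  have "f i * f i \<le> f i * (\<Sum>i\<in>A. f i)" if "i \<in> A" for i
    using assms that member_le_sum[of i A f] by (intro mult_left_mono) simp_all
  then have "(\<Sum>i\<in>A. f i * f i) \<le> (\<Sum>i\<in>A. f i * (\<Sum>i\<in>A. f i))" by (rule sum_mono)
  then show ?thesis by (simp only: power2_eq_square sum_distrib_right[symmetric])
qed

text \<open>
  The shifted coordinates \<open>r i = fst d $ i + \<epsilon>\<close> are nonnegative.  For a given sum \<open>s\<close> of them, their
  sum of squares is at most \<open>s\<^sup>2\<close>, so the squared norm is at most \<open>s\<^sup>2 - 2 \<epsilon> s + q \<epsilon>\<^sup>2\<close>.  The hyperplane
  condition and nonnegativity of the last shifted coordinate give \<open>s \<le> (q + 1) \<epsilon>\<close>; on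
  \<open>0 \<le> s \<le> (q + 1) \<epsilon>\<close> the convex quadratic is largest at the right endpoint.
\<close>

lemma norm_fst_le_in_hyperplane:
  fixes d :: "'q::finite evec"
  assumes "0 \<le> \<epsilon>" and "all_ones \<bullet> d = 0" and "0 \<le> d + \<epsilon> *\<^sub>R all_ones"
  shows "norm (fst d) \<le> \<epsilon> * sqrt ((real CARD('q))\<^sup>2 + real CARD('q) - 1)"
proof -
  let ?q = "real CARD('q)"
  have q: "1 \<le> ?q" by (simp add: Suc_le_eq)
  define r where "r i = fst d $ i + \<epsilon>" for i
  define s where "s = (\<Sum>i\<in>UNIV. r i)"
  have nonneg: "0 \<le> r i" "0 \<le> snd d + \<epsilon>" for i
    using assms(3) by (auto simp: r_def all_ones_def less_eq_prod_def less_eq_vec_def)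
  have sum: "(\<Sum>i\<in>UNIV. fst d $ i) = s - ?q * \<epsilon>"
    by (simp add: s_def r_def sum.distrib)
  have "0 \<le> s" using nonneg by (simp add: s_def sum_nonneg)
  have "s \<le> (?q + 1) * \<epsilon>"
    using assms(2) nonneg(2) sum by (simp add: all_ones_inner algebra_simps)
  have "(norm (fst d))\<^sup>2 = (\<Sum>i\<in>UNIV. (fst d $ i)\<^sup>2)"
    by (simp add: norm_vec_def L2_set_def sum_nonneg)
  also have "\<dots> = (\<Sum>i\<in>UNIV. (r i)\<^sup>2 - 2 * \<epsilon> * r i + \<epsilon>\<^sup>2)"
    by (rule sum.cong) (auto simp: r_def power2_eq_square algebra_simps)
  also have "\<dots> = (\<Sum>i\<in>UNIV. (r i)\<^sup>2) - 2 * \<epsilon> * s + ?q * \<epsilon>\<^sup>2"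
    by (simp add: s_def sum.distrib sum_subtractf sum_distrib_left)
  also have "\<dots> \<le> s\<^sup>2 - 2 * \<epsilon> * s + ?q * \<epsilon>\<^sup>2"
    using sum_squares_le_square_sum[of UNIV r] nonneg by (simp add: s_def)
  also have "s\<^sup>2 - 2 * \<epsilon> * s \<le> (?q + 1) * (?q - 1) * \<epsilon>\<^sup>2"
  proof -
    \<comment> \<open>The quadratic \<open>s\<^sup>2 - 2 \<epsilon> s\<close> takes its endpoint value also at \<open>s = - (q - 1) \<epsilon>\<close>.\<close>
    have "0 \<le> ((?q + 1) * \<epsilon> - s) * (s + (?q - 1) * \<epsilon>)"
      using \<open>0 \<le> s\<close> \<open>s \<le> (?q + 1) * \<epsilon>\<close> q assms(1) by (intro mult_nonneg_nonneg) auto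
    then show ?thesis by (simp add: power2_eq_square algebra_simps)
  qed
  finally have "(norm (fst d))\<^sup>2 \<le> \<epsilon>\<^sup>2 * (?q\<^sup>2 + ?q - 1)"
    by (simp add: power2_eq_square algebra_simps)
  then have "norm (fst d) \<le> sqrt (\<epsilon>\<^sup>2 * (?q\<^sup>2 + ?q - 1))" by (rule real_le_rsqrt)
  then show ?thesis using assms(1) by (simp add: real_sqrt_mult)
qed

lemma hausdorff_dist_le_if_subset:
  assumes "A \<subseteq> B" and "0 \<le> \<delta>" and near: "\<And>b. b \<in> B \<Longrightarrow> \<exists>a\<in>A. dist a b \<le> \<delta>"
  shows "hausdorff_dist A B \<le> ereal \<delta>"
  unfolding hausdorff_dist_def
proof (intro max.boundedI SUP_least)
  fix a assume "a \<in> A"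
  then show "(INF b\<in>B. ereal (dist a b)) \<le> ereal \<delta>"
    using assms by (intro INF_lower2[of a]) auto
next
  fix b assume "b \<in> B"
  with near obtain a where "a \<in> A" "dist a b \<le> \<delta>" by blast
  then show "(INF a\<in>A. ereal (dist a b)) \<le> ereal \<delta>"
    by (intro INF_lower2[of a]) auto
qed

lemma linear_mocp_objective: "linear (mocp_objective G)"
  by (rule linearI)
    (simp_all add: mocp_objective_def matrix_vector_right_distrib inner_add_right
      matrix_vector_mult_scaleR)

lemma mocp_objective_in_hyperplane: "mocp_objective G x \<in> hyperplane_H"
  by (simp add: hyperplane_H_def all_ones_def mocp_objective_def)

theorem theorem14:
  fixes G :: "real^'n^'q"
    and g :: "nat \<Rightarrow> real^'n \<Rightarrow> ereal"
    and m :: nat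
    and \<epsilon> :: real
    and X :: "(real^'n) set"
    and Y Y_inner :: "(real^'q) set"
    and P_inner :: "'q evec set"
  assumes "rank G = CARD('q)"
    and "\<And>i. i \<in> {1..m} \<Longrightarrow> convex_ext (g i)"
    and "X = feasible_set m g"
    and "convex_body X"
    and "Y = (\<lambda>x. G *v x) ` X"
    and "\<epsilon> > 0"
    and "dual_benson_result (mocp_objective G) X \<epsilon> P_inner"
    and "Y_inner = fst ` (P_inner \<inter> hyperplane_H)"
  shows "Y_inner \<subseteq> Y \<and>
    hausdorff_dist Y_inner Y \<le> ereal (\<epsilon> * sqrt ((real CARD('q))\<^sup>2 + real CARD('q) - 1))"
proof -
  let ?\<Gamma> = "mocp_objective G" and ?q = "real CARD('q)"
  obtain S where S: "S \<subseteq> ?\<Gamma> ` X" and P: "P_inner = convex hull S + nonneg_orthant"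
    and shifted: "\<And>x. x \<in> X \<Longrightarrow> ?\<Gamma> x + \<epsilon> *\<^sub>R all_ones \<in> P_inner"
    using dual_benson_result_characterization[OF assms(7)] by blast
  have "convex (?\<Gamma> ` X)"
    using assms(4) by (intro convex_linear_image linear_mocp_objective) (simp add: convex_body_def)
  with S have hull: "convex hull S \<subseteq> ?\<Gamma> ` X" by (rule hull_minimal)
  then have hull_H: "all_ones \<bullet> p = 0" if "p \<in> convex hull S" for p
    using that mocp_objective_in_hyperplane[of G] by (auto simp: hyperplane_H_def)
  have hull_eq: "P_inner \<inter> hyperplane_H = convex hull S"
  proof (intro set_eqI iffI)
    fix y assume "y \<in> P_inner \<inter> hyperplane_H"
    then obtain p r where y: "y = p + r" and p: "p \<in> convex hull S" and r: "0 \<le> r"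
      and "all_ones \<bullet> y = 0"
      by (auto simp: P set_plus_def nonneg_orthant_def hyperplane_H_def)
    then have "all_ones \<bullet> r = 0" using hull_H[OF p] by (simp add: inner_add_right)
    with r have "r = 0" using all_ones_inner_pos by fastforce
    with y p show "y \<in> convex hull S" by simp
  next
    fix y assume y: "y \<in> convex hull S"
    then have "y + 0 \<in> P_inner"
      unfolding P by (intro set_plus_intro) (auto simp: nonneg_orthant_def)
    with y show "y \<in> P_inner \<inter> hyperplane_H" by (simp add: hull_H hyperplane_H_def)
  qed
  have sub: "Y_inner \<subseteq> Y"
    using hull by (auto simp: assms(5,8) hull_eq mocp_objective_def)
  moreover have "hausdorff_dist Y_inner Y \<le> ereal (\<epsilon> * sqrt (?q\<^sup>2 + ?q - 1))"
  proof (rule hausdorff_dist_le_if_subset[OF sub])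
    have "1 \<le> ?q" by (simp add: Suc_le_eq)
    then show "0 \<le> \<epsilon> * sqrt (?q\<^sup>2 + ?q - 1)"
      using assms(6) zero_le_power2[of ?q]
      by (intro mult_nonneg_nonneg real_sqrt_ge_zero) linarith+
  next
    fix b assume "b \<in> Y"
    then obtain x where x: "x \<in> X" and b: "b = fst (?\<Gamma> x)"
      by (auto simp: assms(5) mocp_objective_def)
    from shifted[OF x] obtain p r where eq: "?\<Gamma> x + \<epsilon> *\<^sub>R all_ones = p + r"
      and p: "p \<in> convex hull S" and r: "0 \<le> r"
      by (auto simp: P set_plus_def nonneg_orthant_def)
    have "all_ones \<bullet> (?\<Gamma> x - p) = 0"
      using hull_H[OF p] mocp_objective_in_hyperplane[of G x]
      by (simp add: hyperplane_H_def inner_diff_right)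
    moreover have "0 \<le> (?\<Gamma> x - p) + \<epsilon> *\<^sub>R all_ones"
      using eq r by (simp add: algebra_simps)
    ultimately have "norm (fst (?\<Gamma> x - p)) \<le> \<epsilon> * sqrt (?q\<^sup>2 + ?q - 1)"
      using assms(6) by (intro norm_fst_le_in_hyperplane) auto
    then have "dist (fst p) b \<le> \<epsilon> * sqrt (?q\<^sup>2 + ?q - 1)"
      by (simp add: b dist_norm norm_minus_commute)
    moreover have "fst p \<in> Y_inner" using p by (simp add: assms(8) hull_eq)
    ultimately show "\<exists>a\<in>Y_inner. dist a b \<le> \<epsilon> * sqrt (?q\<^sup>2 + ?q - 1)" by blast
  qed
  ultimately show ?thesis by blast
qed

end
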